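(* Let $r\ge 1$ be an integer, let $H = (V,E)$ be an $r$-uniform hypergraph and let $w \in \mathbb{R}_+^V$. Then $\alpha(H, w) \leq \vartheta(H, w)$. If moreover $r \geq 2$, then $\vartheta(H, w) \leq (r-1)\,\chi^*(\overline{H}, w)$.
   Context: For an integer $r \geq 1$, an $r$-uniform hypergraph $H=(V,E)$ consists of a finite set $V$ and a set $E \subseteq \binom{V}{r}$, where $\binom{V}{r}$ is the set of $r$-element subsets of $V$. The complement $\overline{H}$ is the $r$-uniform hypergraph $(V, \binom{V}{r}\setminus E)$. A set $I \subseteq V$ is independent in $H$ if no edge of $H$ is contained in $I$. For $S \subseteq V$, $\chi_S\in\mathbb{R}^V$ is its characteristic function; $w(S) = \sum_{x \in S} w(x)$. $\alpha(H,w) = \max\{ w(I) : I \subseteq V \text{ independent}\}$. $\mathrm{IND}(H) = \mathrm{conv}\{\chi_I : I \subseteq V \text{ independent}\}$. For $r \geq 2$ and $w \in \mathbb{R}_+^V$, the weighted fractional chromatic number $\chi^*(H,w)$ is the minimum of $\lambda_1 + \cdots + \lambda_k$ over all $k$, all $\lambda_1,\dots,\lambda_k \geq 0$ and all independent sets $I_1,\dots,I_k$ of $H$ such that $\lambda_1\chi_{I_1} + \cdots + \lambda_k\chi_{I_k} = w$. For $r \geq 2$ and $x \in V$, the link of $x$ in $H$ is the $(r-1)$-uniform hypergraph $H_x$ with vertex set $V_x = \{ y \in V \setminus\{x\} : \text{there is } e \in E \text{ containing } x \text{ and } y\}$, in which an $(r-1)$-subset $e$ of $V_x$ is an edge if and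 only if $e \cup \{x\} \in E$. For $A \in \mathbb{R}^{V\times V}$, $A_x \in \mathbb{R}^V$ is the row indexed by $x$; $f[U]$ is the restriction of $f$ to $U \subseteq V$. Positive semidefinite matrices are always symmetric. For a symmetric matrix $A$ with diagonal $a$, write $R(A) = \begin{pmatrix} 1 & a^{\mathsf T} \\ a & A\end{pmatrix}$. The theta body $\mathrm{TH}(H)$ is defined recursively. For $r = 1$, $\mathrm{TH}(H) = \mathrm{IND}(H)$. For $r \geq 2$, $\mathrm{TH}(H)$ is the set of all $f \in \mathbb{R}^V$ for which there is $F \in \mathbb{R}^{V \times V}$ such that $f = \mathrm{diag}\,F$, $F_x[V_x] \in F(x,x)\,\mathrm{TH}(H_x)$ for every $x \in V$ (no constraint is imposed on row $F_x$ if the link $H_x$ is empty), and $R(F)$ is positive semidefinite. The theta number is $\vartheta(H,w) = \max\{ w^{\mathsf T} f : f \in \mathrm{TH}(H)\}$. *)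

theory Defs
  imports "HOL-Analysis.Analysis" "HOL-Library.Function_Algebras" "HOL-Library.Ramsey"
begin

text \<open>
  For a finite set \<open>V :: 'a set\<close>, the space of real vectors indexed by \<open>V\<close> is represented
  by the functions \<open>'a \<Rightarrow> real\<close> that vanish outside \<open>V\<close>. With the pointwise structure below
  this is a subspace of \<open>'a \<Rightarrow> real\<close> that contains \<open>indicator S\<close> for every \<open>S \<subseteq> V\<close>,
  and \<open>convex hull\<close> is the library's.
\<close>

instantiation "fun" :: (type, real_vector) real_vector
begin

definition scaleR_fun :: "real \<Rightarrow> ('a \<Rightarrow> 'b) \<Rightarrow> 'a \<Rightarrow> 'b"
  where "scaleR_fun c f = (\<lambda>x. c *\<^sub>R f x)"

instance
  by standard (auto simp: scaleR_fun_def fun_eq_iff scaleR_add_right scaleR_add_left)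

end

definition vec_restrict :: "('a \<Rightarrow> real) \<Rightarrow> 'a set \<Rightarrow> 'a \<Rightarrow> real"
  where "vec_restrict f U = (\<lambda>x. if x \<in> U then f x else 0)"

definition nonneg_vectors :: "'a set \<Rightarrow> ('a \<Rightarrow> real) set"
  where "nonneg_vectors V = {w. (\<forall>x\<in>V. 0 \<le> w x) \<and> (\<forall>x. x \<notin> V \<longrightarrow> w x = 0)}"


text \<open>
  A hypergraph is given by its vertex set \<open>V\<close> and its edge set \<open>E\<close>; the library's
  \<open>[V]\<^bsup>r\<^esup>\<close> is the set of \<open>r\<close>-element subsets of \<open>V\<close>. The uniformity \<open>r\<close> is passed
  explicitly where it matters, since it cannot be recovered from \<open>E\<close> when \<open>E\<close> is empty.
\<close>

definition uniform_hypergraph :: "nat \<Rightarrow> 'a set \<Rightarrow> 'a set set \<Rightarrow> bool"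
  where "uniform_hypergraph r V E \<longleftrightarrow> finite V \<and> E \<subseteq> [V]\<^bsup>r\<^esup>"

definition complement_edges :: "nat \<Rightarrow> 'a set \<Rightarrow> 'a set set \<Rightarrow> 'a set set"
  where "complement_edges r V E = [V]\<^bsup>r\<^esup> - E"

definition independent_set :: "'a set \<Rightarrow> 'a set set \<Rightarrow> 'a set \<Rightarrow> bool"
  where "independent_set V E I \<longleftrightarrow> I \<subseteq> V \<and> \<not> (\<exists>e\<in>E. e \<subseteq> I)"

definition independence_number :: "'a set \<Rightarrow> 'a set set \<Rightarrow> ('a \<Rightarrow> real) \<Rightarrow> real"
  where "independence_number V E w = Max {(\<Sum>x\<in>I. w x) | I. independent_set V E I}"

definition independent_set_polytope :: "'a set \<Rightarrow> 'a set set \<Rightarrow> ('a \<Rightarrow> real) set"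
  where "independent_set_polytope V E = convex hull {indicator I | I. independent_set V E I}"

definition fractional_chromatic_number :: "'a set \<Rightarrow> 'a set set \<Rightarrow> ('a \<Rightarrow> real) \<Rightarrow> real"
  where "fractional_chromatic_number V E w =
    (LEAST s. \<exists>(k::nat) (l :: nat \<Rightarrow> real) (I :: nat \<Rightarrow> 'a set).
       (\<forall>i\<in>{1..k}. 0 \<le> l i \<and> independent_set V E (I i)) \<and>
       (\<Sum>i=1..k. l i *\<^sub>R indicator (I i)) = w \<and>
       s = (\<Sum>i=1..k. l i))"

definition link_vertices :: "'a set \<Rightarrow> 'a set set \<Rightarrow> 'a \<Rightarrow> 'a set"
  where "link_vertices V E x = {y \<in> V - {x}. \<exists>e\<in>E. x \<in> e \<and> y \<in> e}"

definition link_edges :: "nat \<Rightarrow> 'a set \<Rightarrow> 'a set set \<Rightarrow> 'a \<Rightarrow> 'a set set"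
  where "link_edges r V E x = {e \<in> [link_vertices V E x]\<^bsup>(r - 1)\<^esup>. e \<union> {x} \<in> E}"

definition psd_on :: "'i set \<Rightarrow> ('i \<Rightarrow> 'i \<Rightarrow> real) \<Rightarrow> bool"
  where "psd_on S A \<longleftrightarrow>
    (\<forall>x\<in>S. \<forall>y\<in>S. A x y = A y x) \<and>
    (\<forall>z. 0 \<le> (\<Sum>x\<in>S. \<Sum>y\<in>S. z x * A x y * z y))"

text \<open>
  The matrix \<open>A\<close> bordered by its diagonal: the extra row and column are indexed by \<open>None\<close>,
  so the index set of the bordered matrix is \<open>insert None (Some ` V)\<close>.
\<close>

fun bordered :: "('a \<Rightarrow> 'a \<Rightarrow> real) \<Rightarrow> 'a option \<Rightarrow> 'a option \<Rightarrow> real"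
  where
    "bordered A None None = 1"
  | "bordered A None (Some y) = A y y"
  | "bordered A (Some x) None = A x x"
  | "bordered A (Some x) (Some y) = A x y"

text \<open>
  Only the entries of \<open>F\<close> in \<open>V \<times> V\<close> are used. There is deliberately no equation
  for uniformity \<open>0\<close>.
\<close>

fun theta_body :: "nat \<Rightarrow> 'a set \<Rightarrow> 'a set set \<Rightarrow> ('a \<Rightarrow> real) set"
  where
    "theta_body (Suc 0) V E = independent_set_polytope V E"
  | "theta_body (Suc (Suc r)) V E =
      {f. \<exists>F :: 'a \<Rightarrow> 'a \<Rightarrow> real.
         f = vec_restrict (\<lambda>x. F x x) V \<and>
         (\<forall>x\<in>V. link_vertices V E x \<noteq> {} \<longrightarrow>
            vec_restrict (F x) (link_vertices V E x)
              \<in> (\<lambda>g. F x x *\<^sub>R g) `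
                  theta_body (Suc r) (link_vertices V E x) (link_edges (Suc (Suc r)) V E x)) \<and>
         psd_on (insert None (Some ` V)) (bordered F)}"

text \<open>
  \<open>Greatest\<close> and \<open>Least\<close> (rather than \<open>Sup\<close> and \<open>Inf\<close>) render the maximum here and the
  minimum in \<^const>\<open>fractional_chromatic_number\<close> literally, attainment included.
\<close>

definition theta_number :: "nat \<Rightarrow> 'a set \<Rightarrow> 'a set set \<Rightarrow> ('a \<Rightarrow> real) \<Rightarrow> real"
  where "theta_number r V E w =
    (GREATEST t. \<exists>f \<in> theta_body r V E. t = (\<Sum>x\<in>V. w x * f x))"

end

theory Submission
  imports Defs
begin

text \<open>
  \<^bold>\<open>Lower bound.\<close> For an independent set \<open>I\<close>, the rank-one matrix
  \<open>F = \<chi>\<^sub>I \<chi>\<^sub>I\<^sup>T\<close> shows that \<open>\<chi>\<^sub>I\<close> lies in the theta body: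
  \<open>R(F)\<close> is the Gram matrix \<open>v v\<^sup>T\<close> of \<open>v = (1, \<chi>\<^sub>I)\<close>, and the row of \<open>x \<in> I\<close> restricts to the
  characteristic vector of a set that is independent in the link of \<open>x\<close>
  (lemma \<open>indicator_in_theta_body\<close>, by induction on the uniformity).

  \<^bold>\<open>Upper bound.\<close> An independent set \<open>K\<close> of the complement is a clique, and every \<open>f\<close>
  in the theta body satisfies \<open>f(K) \<le> r - 1\<close> (lemma \<open>theta_body_clique_bound\<close>, again by
  induction). If \<open>K\<close> has at least \<open>r\<close> elements then, for each \<open>x \<in> K\<close>, the set \<open>K - {x}\<close> is a
  clique of the link of \<open>x\<close>, so the induction hypothesis bounds the sum of row \<open>x\<close> of \<open>F\<close> over
  \<open>K\<close> by \<open>(r - 1) F(x,x)\<close>; positive semidefiniteness of \<open>R(F)\<close> then gives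
  \<open>f(K)\<^sup>2 \<le> \<chi>\<^sub>K\<^sup>T F \<chi>\<^sub>K \<le> (r - 1) f(K)\<close>. Writing
  \<open>w\<close> as a combination \<open>\<Sum>\<^sub>i \<lambda>\<^sub>i \<chi>\<^sub>K\<^sub>i\<close> of cliques gives
  \<open>w\<^sup>T f = \<Sum>\<^sub>i \<lambda>\<^sub>i f(K\<^sub>i) \<le> (r - 1) \<Sum>\<^sub>i \<lambda>\<^sub>i\<close>.

  \<^bold>\<open>Attainment.\<close> The two inequalities speak about a maximum and a minimum, which must be
  shown to exist. Both follow from compactness in the product topology on functions: the theta
  body is the image under the diagonal map of a compact set of matrices (lemma
  \<open>compact_theta_body\<close>), and the minimum in the fractional chromatic number may be taken over
  weights on the finite family of independent sets, which form a compact set once their total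
  is bounded (lemma \<open>fractional_chromatic_number_attained\<close>).
\<close>

section \<open>Compactness in function spaces\<close>

text \<open>
  Compact sets of functions have to be known to be closed, so that conditions of the form
  "this part of the matrix lies in a compact set" cut out closed sets. They are, since
  a product of Hausdorff spaces is Hausdorff, whatever the index set.
\<close>

lemma compact_imp_closed_functions:
  fixes S :: "('a \<Rightarrow> 'b::metric_space) set"
  assumes "compact S"
  shows "closed S"
proof -
  have "Hausdorff_space (euclidean :: ('a \<Rightarrow> 'b) topology)"
    unfolding euclidean_product_topology[symmetric] Hausdorff_space_product_topology by simp
  then have "closedin euclidean S"
    using assms by (intro compactin_imp_closedin) auto
  then show ?thesis by simp
qed

lemma compact_function_box:
  fixes K :: "'a \<Rightarrow> 'b::topological_space set"
  assumes "\<And>x. compact (K x)"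
  shows "compact {f. \<forall>x. f x \<in> K x}"
proof -
  have "compactin (product_topology (\<lambda>_. euclidean) UNIV) (PiE UNIV K)"
    using assms by (simp add: compactin_PiE)
  moreover have "PiE UNIV K = {f. \<forall>x. f x \<in> K x}"
    by (auto simp: PiE_def Pi_def)
  ultimately show ?thesis
    by (simp add: euclidean_product_topology)
qed

lemma continuous_on_entry:
  "continuous_on S (\<lambda>F :: 'a \<Rightarrow> 'b \<Rightarrow> real. F x y)"
  by (intro continuous_on_product_then_coordinatewise[of S "\<lambda>F. F x" y]
      continuous_on_product_then_coordinatewise[of S "\<lambda>F. F" x] continuous_on_id)

lemma continuous_on_coordinate:
  "continuous_on S (\<lambda>f :: 'a \<Rightarrow> real. f x)"
  by (intro continuous_on_product_then_coordinatewise[of S "\<lambda>f. f" x] continuous_on_id)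

lemma sum_fun_apply: "(\<Sum>i\<in>A. (f i :: 'a \<Rightarrow> real)) x = (\<Sum>i\<in>A. f i x)"
  by (induction A rule: infinite_finite_induct) auto

text \<open>
  The hull is the continuous image of the simplex of coefficient vectors.
\<close>

lemma compact_convex_hull_finite_functions:
  fixes S :: "('a \<Rightarrow> real) set"
  assumes fin: "finite S"
  shows "compact (convex hull S)"
proof -
  define W where
    "W = {u. \<forall>v. u v \<in> (if v \<in> S then {0..1::real} else {0})} \<inter> {u. sum u S = 1}"
  have "compact W"
    unfolding W_def
    by (intro compact_Int_closed compact_function_box closed_Collect_eq continuous_intros
        continuous_on_coordinate) auto
  moreover have "continuous_on W (\<lambda>u. \<Sum>v\<in>S. u v *\<^sub>R v)"
    by (rule continuous_on_coordinatewise_then_product)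
      (simp add: sum_fun_apply scaleR_fun_def,
       intro continuous_intros continuous_on_coordinate)
  ultimately have "compact ((\<lambda>u. \<Sum>v\<in>S. u v *\<^sub>R v) ` W)"
    by (rule compact_continuous_image[rotated])
  moreover have "convex hull S = (\<lambda>u. \<Sum>v\<in>S. u v *\<^sub>R v) ` W"
  proof (intro equalityI subsetI)
    fix y assume "y \<in> convex hull S"
    then obtain u where u: "\<forall>v\<in>S. 0 \<le> u v" "sum u S = 1" "(\<Sum>v\<in>S. u v *\<^sub>R v) = y"
      unfolding convex_hull_finite[OF fin] by auto
    have "u v \<le> 1" if "v \<in> S" for v
      using member_le_sum[of v S u] that u fin by auto
    then have "(\<lambda>v. if v \<in> S then u v else 0) \<in> W"
      using u unfolding W_def by auto
    moreover have "y = (\<Sum>v\<in>S. (if v \<in> S then u v else 0) *\<^sub>R v)"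
      using u(3) by (auto intro: sum.cong)
    ultimately show "y \<in> (\<lambda>u. \<Sum>v\<in>S. u v *\<^sub>R v) ` W"
      by (intro image_eqI)
  next
    fix y assume "y \<in> (\<lambda>u. \<Sum>v\<in>S. u v *\<^sub>R v) ` W"
    then obtain u where "u \<in> W" and y: "y = (\<Sum>v\<in>S. u v *\<^sub>R v)" by blast
    then have "\<forall>v\<in>S. 0 \<le> u v" "sum u S = 1"
      unfolding W_def by (fastforce split: if_splits)+
    with y show "y \<in> convex hull S"
      unfolding convex_hull_finite[OF fin] by blast
  qed
  ultimately show ?thesis by simp
qed

section \<open>Positive semidefinite bordered matrices\<close>

lemma bordered_quadratic_form:
  assumes "finite V"
  shows "(\<Sum>i\<in>insert None (Some ` V). \<Sum>j\<in>insert None (Some ` V). z i * bordered F i j * z j)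
    = (z None)\<^sup>2 + 2 * z None * (\<Sum>x\<in>V. z (Some x) * F x x)
      + (\<Sum>x\<in>V. \<Sum>y\<in>V. z (Some x) * F x y * z (Some y))"
proof -
  have border: "(\<Sum>j\<in>insert None (Some ` V). h j) = h None + (\<Sum>x\<in>V. h (Some x))"
    for h :: "'a option \<Rightarrow> real"
    using assms by (subst sum.insert) (auto simp: sum.reindex)
  show ?thesis
    by (simp add: border sum.distrib power2_eq_square sum_distrib_left sum_distrib_right
        algebra_simps)
qed

lemma psd_on_bordered_iff:
  assumes "finite V"
  shows "psd_on (insert None (Some ` V)) (bordered F) \<longleftrightarrow>
    (\<forall>x\<in>V. \<forall>y\<in>V. F x y = F y x) \<and>
    (\<forall>c z. 0 \<le> c\<^sup>2 + 2 * c * (\<Sum>x\<in>V. z x * F x x) + (\<Sum>x\<in>V. \<Sum>y\<in>V. z x * F x y * z y))"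
    (is "_ \<longleftrightarrow> ?sym \<and> ?form")
proof -
  have "(\<forall>z. 0 \<le> (z None)\<^sup>2 + 2 * z None * (\<Sum>x\<in>V. z (Some x) * F x x)
      + (\<Sum>x\<in>V. \<Sum>y\<in>V. z (Some x) * F x y * z (Some y))) \<longleftrightarrow> ?form" (is "?opt \<longleftrightarrow> _")
  proof
    assume A: ?opt
    show ?form
    proof (intro allI)
      fix c z
      show "0 \<le> c\<^sup>2 + 2 * c * (\<Sum>x\<in>V. z x * F x x) + (\<Sum>x\<in>V. \<Sum>y\<in>V. z x * F x y * z y)"
        using A[rule_format, of "\<lambda>i. case i of None \<Rightarrow> c | Some x \<Rightarrow> z x"] by simp
    qed
  next
    assume A: ?form
    show ?opt
    proof
      fix z :: "'a option \<Rightarrow> real"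
      show "0 \<le> (z None)\<^sup>2 + 2 * z None * (\<Sum>x\<in>V. z (Some x) * F x x)
          + (\<Sum>x\<in>V. \<Sum>y\<in>V. z (Some x) * F x y * z (Some y))"
        by (rule A[rule_format, of "z None" "\<lambda>x. z (Some x)"])
    qed
  qed
  then show ?thesis
    unfolding psd_on_def bordered_quadratic_form[OF assms] by auto
qed

text \<open>
  Among the quadratic forms \<open>c\<^sup>2 + 2 c f(K) + \<chi>\<^sub>K\<^sup>T F \<chi>\<^sub>K\<close>, the choice
  \<open>c = - f(K)\<close> minimizes the value; this is the Schur complement of the corner entry.
\<close>

lemma psd_bordered_diagonal_sum_sq:
  assumes fin: "finite V" and psd: "psd_on (insert None (Some ` V)) (bordered F)" and "K \<subseteq> V"
  shows "(\<Sum>x\<in>K. F x x)\<^sup>2 \<le> (\<Sum>x\<in>K. \<Sum>y\<in>K. F x y)"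
proof -
  have restrict: "(\<Sum>x\<in>V. (if x \<in> K then 1 else 0) * h x) = (\<Sum>x\<in>K. h x)" for h :: "'a \<Rightarrow> real"
  proof -
    have "(\<Sum>x\<in>K. h x) = (\<Sum>x\<in>K. (if x \<in> K then 1 else 0) * h x)" by simp
    also have "\<dots> = (\<Sum>x\<in>V. (if x \<in> K then 1 else 0) * h x)"
      by (rule sum.mono_neutral_left) (use assms in auto)
    finally show ?thesis ..
  qed
  define s where "s = (\<Sum>x\<in>K. F x x)"
  let ?z = "\<lambda>x. if x \<in> K then 1 else 0 :: real"
  have "0 \<le> (- s)\<^sup>2 + 2 * (- s) * (\<Sum>x\<in>V. ?z x * F x x) + (\<Sum>x\<in>V. \<Sum>y\<in>V. ?z x * F x y * ?z y)"
    by (rule psd[unfolded psd_on_bordered_iff[OF fin], THEN conjunct2, rule_format])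
  also have "(\<Sum>x\<in>V. \<Sum>y\<in>V. ?z x * F x y * ?z y) = (\<Sum>x\<in>V. ?z x * (\<Sum>y\<in>V. ?z y * F x y))"
    unfolding sum_distrib_left by (simp only: ac_simps)
  finally have "0 \<le> (- s)\<^sup>2 + 2 * (- s) * s + (\<Sum>x\<in>K. \<Sum>y\<in>K. F x y)"
    unfolding restrict s_def .
  then show ?thesis
    unfolding s_def[symmetric] by (simp add: power2_eq_square)
qed

lemma psd_bordered_diagonal_bounds:
  assumes "finite V" and "psd_on (insert None (Some ` V)) (bordered F)" and "x \<in> V"
  shows "0 \<le> F x x" and "F x x \<le> 1"
proof -
  have sq: "(F x x)\<^sup>2 \<le> F x x"
    using psd_bordered_diagonal_sum_sq[OF assms(1,2), of "{x}"] assms(3) by simp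
  then show nonneg: "0 \<le> F x x"
    using zero_le_power2 order_trans by blast
  show "F x x \<le> 1"
  proof (rule ccontr)
    assume "\<not> F x x \<le> 1"
    then have "F x x * 1 < F x x * F x x" using nonneg by (intro mult_strict_left_mono) auto
    with sq show False by (simp add: power2_eq_square)
  qed
qed

text \<open>
  The \<open>2 \<times> 2\<close> principal minors bound the off-diagonal entries; this is what makes the
  matrices in the definition of the theta body range over a bounded set.
\<close>

lemma psd_bordered_entry_bound:
  assumes fin: "finite V" and psd: "psd_on (insert None (Some ` V)) (bordered F)"
    and x: "x \<in> V" and y: "y \<in> V"
  shows "\<bar>F x y\<bar> \<le> 1"
proof -
  have form: "0 \<le> F x x + t * F x y + t * F y x + t * t * F y y" for t
  proof -
    let ?z = "\<lambda>u. (if u = x then 1 else 0) + t * (if u = y then 1 else 0)"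
    have pick: "(\<Sum>u\<in>V. ?z u * h u) = h x + t * h y" for h :: "'a \<Rightarrow> real"
    proof -
      have "(\<Sum>u\<in>V. ?z u * h u)
          = (\<Sum>u\<in>V. if u = x then h u else 0) + t * (\<Sum>u\<in>V. if u = y then h u else 0)"
        unfolding sum_distrib_left sum.distrib[symmetric]
        by (rule sum.cong) (auto simp: algebra_simps)
      then show ?thesis using x y fin by simp
    qed
    have "0 \<le> 0\<^sup>2 + 2 * 0 * (\<Sum>u\<in>V. ?z u * F u u) + (\<Sum>u\<in>V. \<Sum>v\<in>V. ?z u * F u v * ?z v)"
      by (rule psd[unfolded psd_on_bordered_iff[OF fin], THEN conjunct2, rule_format])
    also have "(\<Sum>u\<in>V. \<Sum>v\<in>V. ?z u * F u v * ?z v) = (\<Sum>u\<in>V. ?z u * (\<Sum>v\<in>V. ?z v * F u v))"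
      unfolding sum_distrib_left by (simp only: ac_simps)
    finally show ?thesis
      unfolding pick by (simp add: algebra_simps)
  qed
  have "F x y = F y x"
    using psd x y unfolding psd_on_bordered_iff[OF fin] by blast
  then show ?thesis
    using form[of 1] form[of "-1"] psd_bordered_diagonal_bounds[OF fin psd x]
      psd_bordered_diagonal_bounds[OF fin psd y] by auto
qed

section \<open>Compactness of the theta body\<close>

lemma finite_independent_sets: "finite V \<Longrightarrow> finite {I. independent_set V E I}"
  by (rule finite_subset[of _ "Pow V"]) (auto simp: independent_set_def)

lemma link_vertices_subset: "link_vertices V E x \<subseteq> V"
  by (auto simp: link_vertices_def)

text \<open>
  The existential quantifier over \<open>F\<close> may be restricted to matrices that vanish outside
  \<open>V \<times> V\<close>. These form a compact set: their entries are bounded, and the condition on row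
  \<open>x\<close> says that \<open>(F(x,x), F\<^sub>x[V\<^sub>x])\<close> lies in \<open>{(c, c g) | c \<in> [0,1], g \<in> TH(H\<^sub>x)}\<close>, which by
  induction is the continuous image of a compact set. The pair is coded as one function on
  an option type, so that this compact set is seen to be closed as a set of functions.
\<close>

lemma compact_theta_body:
  assumes "finite V"
  shows "compact (theta_body (Suc n) V E)"
  using assms
proof (induction n arbitrary: V E)
  case 0
  have "finite ((indicator :: 'a set \<Rightarrow> 'a \<Rightarrow> real) ` {I. independent_set V E I})"
    using finite_independent_sets[OF 0] by blast
  moreover have "{indicator I | I. independent_set V E I}
      = (indicator :: 'a set \<Rightarrow> 'a \<Rightarrow> real) ` {I. independent_set V E I}" by auto
  ultimately show ?case
    by (simp add: independent_set_polytope_def compact_convex_hull_finite_functions)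
next
  case (Suc n)
  let ?U = "link_vertices V E"
  let ?T = "\<lambda>x. theta_body (Suc n) (?U x) (link_edges (Suc (Suc n)) V E x)"
  define tag where "tag c g = case_option c g" for c and g :: "'a \<Rightarrow> real"
  define cone where "cone x = (\<lambda>(c, g). tag c (c *\<^sub>R g)) ` ({0..1} \<times> ?T x)" for x
  define box where
    "box = {F :: 'a \<Rightarrow> 'a \<Rightarrow> real.
       \<forall>x. F x \<in> {f. \<forall>y. f y \<in> (if x \<in> V \<and> y \<in> V then {-1..1} else {0})}}"
  define good where
    "good F \<longleftrightarrow> psd_on (insert None (Some ` V)) (bordered F) \<and>
       (\<forall>x\<in>V. ?U x \<noteq> {} \<longrightarrow> tag (F x x) (vec_restrict (F x) (?U x)) \<in> cone x)"
    for F :: "'a \<Rightarrow> 'a \<Rightarrow> real"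
  have tag_inject: "tag c g = tag d h \<longleftrightarrow> c = d \<and> g = h" for c d g h
  proof
    assume eq: "tag c g = tag d h"
    show "c = d \<and> g = h"
      using fun_cong[OF eq, of None] fun_cong[OF eq, of "Some y" for y]
      by (auto simp: tag_def fun_eq_iff)
  qed simp
  have "compact box"
    unfolding box_def by (intro compact_function_box) auto
  have "closed (cone x)" for x
  proof -
    have "compact (?T x)"
      using Suc.prems by (intro Suc.IH finite_subset[OF link_vertices_subset])
    then have "compact ({0..1::real} \<times> ?T x)"
      by (intro compact_Times) auto
    moreover have "continuous_on ({0..1} \<times> ?T x) (\<lambda>(c, g). tag c (c *\<^sub>R g))"
    proof (rule continuous_on_coordinatewise_then_product)
      fix i
      show "continuous_on ({0..1} \<times> ?T x) (\<lambda>p. (case p of (c, g) \<Rightarrow> tag c (c *\<^sub>R g)) i)"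
        by (cases i) (simp_all add: tag_def scaleR_fun_def case_prod_beta continuous_on_fst
            continuous_on_mult[OF _ continuous_on_product_then_coordinatewise[OF
                continuous_on_snd[OF continuous_on_id]]])
    qed
    ultimately show ?thesis
      unfolding cone_def by (intro compact_imp_closed_functions compact_continuous_image)
  qed
  then have "closed ((\<lambda>F. tag (F x x) (vec_restrict (F x) (?U x))) -` cone x)" for x
  proof (rule closed_vimage)
    show "continuous_on UNIV (\<lambda>F :: 'a \<Rightarrow> 'a \<Rightarrow> real. tag (F x x) (vec_restrict (F x) (?U x)))"
    proof (rule continuous_on_coordinatewise_then_product)
      fix i
      show "continuous_on UNIV
          (\<lambda>F :: 'a \<Rightarrow> 'a \<Rightarrow> real. tag (F x x) (vec_restrict (F x) (?U x)) i)"
        by (cases i; cases "the i \<in> ?U x")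
          (simp_all add: tag_def vec_restrict_def continuous_on_entry)
    qed
  qed
  then have link_closed:
    "closed {F. tag (F x x) (vec_restrict (F x) (?U x)) \<in> cone x}" for x
    by (simp add: vimage_def)
  have "closed {F. good F}"
    unfolding good_def psd_on_bordered_iff[OF Suc.prems] Ball_def
    by (intro closed_Collect_conj closed_Collect_all closed_Collect_imp open_Collect_const
        link_closed closed_Collect_eq closed_Collect_le continuous_intros continuous_on_entry)
  with \<open>compact box\<close> have "compact (box \<inter> {F. good F})"
    by (rule compact_Int_closed)
  moreover have "continuous_on (box \<inter> {F. good F}) (\<lambda>F. vec_restrict (\<lambda>x. F x x) V)"
  proof (rule continuous_on_coordinatewise_then_product)
    fix y
    show "continuous_on (box \<inter> {F. good F}) (\<lambda>F. vec_restrict (\<lambda>x. F x x) V y)"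
      by (cases "y \<in> V") (simp_all add: vec_restrict_def continuous_on_entry)
  qed
  ultimately have "compact ((\<lambda>F. vec_restrict (\<lambda>x. F x x) V) ` (box \<inter> {F. good F}))"
    by (rule compact_continuous_image[rotated])
  moreover have "theta_body (Suc (Suc n)) V E
      = (\<lambda>F. vec_restrict (\<lambda>x. F x x) V) ` (box \<inter> {F. good F})"
  proof (intro equalityI subsetI)
    fix f assume "f \<in> theta_body (Suc (Suc n)) V E"
    then obtain F where f: "f = vec_restrict (\<lambda>x. F x x) V"
      and rows: "\<And>x. x \<in> V \<Longrightarrow> ?U x \<noteq> {} \<Longrightarrow>
        vec_restrict (F x) (?U x) \<in> (\<lambda>g. F x x *\<^sub>R g) ` ?T x"
      and psd: "psd_on (insert None (Some ` V)) (bordered F)"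
      by auto
    define G where "G x y = (if x \<in> V \<and> y \<in> V then F x y else 0)" for x y
    have G: "G x y = F x y" if "x \<in> V" "y \<in> V" for x y
      using that by (simp add: G_def)
    have "psd_on (insert None (Some ` V)) (bordered G)"
      using psd unfolding psd_on_bordered_iff[OF Suc.prems] by (simp add: G cong: sum.cong)
    moreover have "tag (G x x) (vec_restrict (G x) (?U x)) \<in> cone x"
      if x: "x \<in> V" "?U x \<noteq> {}" for x
    proof -
      have "vec_restrict (G x) (?U x) = vec_restrict (F x) (?U x)"
        using x link_vertices_subset[of V E x]
        by (auto simp: vec_restrict_def fun_eq_iff intro!: G)
      moreover obtain g where "g \<in> ?T x" "vec_restrict (F x) (?U x) = F x x *\<^sub>R g"
        using rows[OF x] by blast
      moreover have "F x x \<in> {0..1}"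
        using psd_bordered_diagonal_bounds[OF Suc.prems psd x(1)] by simp
      ultimately show ?thesis
        using x by (auto simp: cone_def G intro!: image_eqI[of _ _ "(F x x, g)"])
    qed
    moreover have "G \<in> box"
      using psd_bordered_entry_bound[OF Suc.prems psd]
      by (fastforce simp: box_def G_def abs_le_iff)
    moreover have "f = vec_restrict (\<lambda>x. G x x) V"
      by (simp add: f vec_restrict_def G fun_eq_iff)
    ultimately show "f \<in> (\<lambda>F. vec_restrict (\<lambda>x. F x x) V) ` (box \<inter> {F. good F})"
      unfolding good_def by blast
  next
    fix f assume "f \<in> (\<lambda>F. vec_restrict (\<lambda>x. F x x) V) ` (box \<inter> {F. good F})"
    then obtain F where "good F" and f: "f = vec_restrict (\<lambda>x. F x x) V" by blast
    have "vec_restrict (F x) (?U x) \<in> (\<lambda>g. F x x *\<^sub>R g) ` ?T x" if x: "x \<in> V" "?U x \<noteq> {}" for x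
    proof -
      have "tag (F x x) (vec_restrict (F x) (?U x)) \<in> cone x"
        using \<open>good F\<close> x unfolding good_def by blast
      then obtain g where "g \<in> ?T x" "vec_restrict (F x) (?U x) = F x x *\<^sub>R g"
        unfolding cone_def by (auto simp: tag_inject simp del: theta_body.simps)
      then show ?thesis by blast
    qed
    with \<open>good F\<close> f show "f \<in> theta_body (Suc (Suc n)) V E"
      unfolding good_def by auto
  qed
  ultimately show ?case by simp
qed

lemma theta_number_attained:
  assumes "finite V" and "theta_body (Suc n) V E \<noteq> {}"
  obtains f where "f \<in> theta_body (Suc n) V E"
    and "theta_number (Suc n) V E w = (\<Sum>x\<in>V. w x * f x)"
    and "\<And>g. g \<in> theta_body (Suc n) V E \<Longrightarrow> (\<Sum>x\<in>V. w x * g x) \<le> (\<Sum>x\<in>V. w x * f x)"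
proof -
  have "continuous_on (theta_body (Suc n) V E) (\<lambda>f. \<Sum>x\<in>V. w x * f x)"
    by (intro continuous_intros continuous_on_coordinate)
  then obtain f where f: "f \<in> theta_body (Suc n) V E"
    "\<And>g. g \<in> theta_body (Suc n) V E \<Longrightarrow> (\<Sum>x\<in>V. w x * g x) \<le> (\<Sum>x\<in>V. w x * f x)"
    using continuous_attains_sup[OF compact_theta_body[OF assms(1)] assms(2)] by blast
  moreover have "theta_number (Suc n) V E w = (\<Sum>x\<in>V. w x * f x)"
    unfolding theta_number_def by (rule Greatest_equality) (use f in blast)+
  ultimately show ?thesis by (intro that)
qed

section \<open>Independent sets and cliques against the theta body\<close>

lemma indicator_in_theta_body:
  assumes "finite V" and "independent_set V E I"
  shows "indicator I \<in> theta_body (Suc n) V E"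
  using assms
proof (induction n arbitrary: V E I)
  case 0
  then show ?case
    by (auto simp: independent_set_polytope_def intro!: hull_inc)
next
  case (Suc n)
  let ?U = "link_vertices V E"
  let ?L = "link_edges (Suc (Suc n)) V E"
  define F where "F x y = (indicator I x * indicator I y :: real)" for x y
  have "I \<subseteq> V" using Suc.prems(2) by (simp add: independent_set_def)
  have finU: "finite (?U x)" for x
    using Suc.prems(1) by (rule finite_subset[OF link_vertices_subset])
  have "indicator I = vec_restrict (\<lambda>x. F x x) V"
    using \<open>I \<subseteq> V\<close> by (auto simp: vec_restrict_def F_def fun_eq_iff indicator_def)
  moreover have "vec_restrict (F x) (?U x) \<in> (\<lambda>g. F x x *\<^sub>R g) ` theta_body (Suc n) (?U x) (?L x)"
    if "x \<in> V" for x
  proof -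
    \<comment> \<open>If \<open>x \<notin> I\<close> then row \<open>x\<close> vanishes and any point of the link's theta body will do.\<close>
    define J where "J = (if x \<in> I then I \<inter> ?U x else {})"
    have "independent_set (?U x) (?L x) J"
      unfolding independent_set_def
    proof (intro conjI notI)
      show "J \<subseteq> ?U x" by (simp add: J_def)
      assume "\<exists>e\<in>?L x. e \<subseteq> J"
      then obtain e where e: "e \<in> ?L x" "e \<subseteq> J" by blast
      then have "card e = Suc n" "e \<union> {x} \<in> E"
        by (simp_all add: link_edges_def nsets_def)
      moreover from this e have "x \<in> I" "e \<subseteq> I"
        by (auto simp: J_def split: if_splits)
      ultimately have "e \<union> {x} \<in> E" "e \<union> {x} \<subseteq> I" by simp_all
      then show False
        using Suc.prems(2) unfolding independent_set_def by blast
    qed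
    then have "indicator J \<in> theta_body (Suc n) (?U x) (?L x)"
      by (intro Suc.IH finU)
    moreover have "vec_restrict (F x) (?U x) = F x x *\<^sub>R indicator J"
      by (auto simp: vec_restrict_def F_def J_def scaleR_fun_def fun_eq_iff indicator_def)
    ultimately show ?thesis by blast
  qed
  moreover have "psd_on (insert None (Some ` V)) (bordered F)"
    unfolding psd_on_bordered_iff[OF Suc.prems(1)]
  proof (intro conjI ballI allI)
    fix c and z :: "'a \<Rightarrow> real"
    have idem: "F x x = indicator I x" for x by (simp add: F_def indicator_def)
    define s where "s = (\<Sum>x\<in>V. z x * indicator I x)"
    have "(\<Sum>x\<in>V. \<Sum>y\<in>V. z x * F x y * z y) = s\<^sup>2"
      unfolding s_def F_def power2_eq_square sum_product by (simp add: ac_simps)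
    then have "c\<^sup>2 + 2 * c * (\<Sum>x\<in>V. z x * F x x) + (\<Sum>x\<in>V. \<Sum>y\<in>V. z x * F x y * z y)
        = (c + s)\<^sup>2"
      unfolding idem s_def[symmetric] by (simp add: power2_sum)
    then show "0 \<le> c\<^sup>2 + 2 * c * (\<Sum>x\<in>V. z x * F x x) + (\<Sum>x\<in>V. \<Sum>y\<in>V. z x * F x y * z y)"
      by simp
  qed (simp add: F_def)
  ultimately show ?case by auto
qed

lemma independent_set_complement_iff:
  "independent_set V (complement_edges r V E) K \<longleftrightarrow>
     K \<subseteq> V \<and> (\<forall>e\<in>[K]\<^bsup>r\<^esup>. e \<in> E)"
  unfolding independent_set_def complement_edges_def nsets_def by blast

text \<open>
  Every vertex of a clique with at least \<open>r\<close> elements is joined to all the others: any two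
  vertices lie in a common \<open>r\<close>-subset of the clique, which is an edge.
\<close>

lemma clique_minus_vertex_subset_link:
  assumes "finite V" and clique: "independent_set V (complement_edges (Suc (Suc n)) V E) K"
    and card: "Suc (Suc n) \<le> card K" and x: "x \<in> K"
  shows "K - {x} \<subseteq> link_vertices V E x"
proof
  fix y assume y: "y \<in> K - {x}"
  have KV: "K \<subseteq> V" and edge: "\<And>e. e \<in> [K]\<^bsup>Suc (Suc n)\<^esup> \<Longrightarrow> e \<in> E"
    using clique unfolding independent_set_complement_iff by blast+
  have "finite K" using KV assms(1) finite_subset by blast
  then have "n \<le> card (K - {x, y})"
    using card x y by (auto simp: card_Diff_subset card_insert_if)
  then obtain S where S: "S \<subseteq> K - {x, y}" "card S = n" "finite S"
    using obtain_subset_with_card_n by blast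
  then have "card (insert x (insert y S)) = Suc (Suc n)"
    using y by (subst card_insert_disjoint; auto)+
  then have "insert x (insert y S) \<in> E"
    using S x y by (intro edge) (auto simp: nsets_def)
  then show "y \<in> link_vertices V E x"
    using y KV unfolding link_vertices_def by blast
qed

lemma clique_minus_vertex_clique_in_link:
  assumes "finite V" and clique: "independent_set V (complement_edges (Suc (Suc n)) V E) K"
    and card: "Suc (Suc n) \<le> card K" and x: "x \<in> K"
  shows "independent_set (link_vertices V E x)
    (complement_edges (Suc n) (link_vertices V E x) (link_edges (Suc (Suc n)) V E x)) (K - {x})"
  unfolding independent_set_complement_iff
proof (intro conjI ballI)
  show sub: "K - {x} \<subseteq> link_vertices V E x"
    by (rule clique_minus_vertex_subset_link[OF assms])
  fix e assume e: "e \<in> [K - {x}]\<^bsup>Suc n\<^esup>"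
  then have "insert x e \<in> [K]\<^bsup>Suc (Suc n)\<^esup>"
    using x by (auto simp: nsets_def card_insert_if)
  then have "insert x e \<in> E"
    using clique unfolding independent_set_complement_iff by blast
  then show "e \<in> link_edges (Suc (Suc n)) V E x"
    using e sub by (auto simp: link_edges_def nsets_def)
qed

text \<open>
  For uniformity one, a clique consists of vertices that are themselves edges and hence lie in
  no independent set. In the inductive step a clique with fewer than \<open>r\<close> elements is not
  constrained by \<open>E\<close> at all, but there the bound \<open>f(x) \<le> 1\<close> on each coordinate is enough.
\<close>

lemma theta_body_clique_bound:
  assumes "finite V" and "f \<in> theta_body (Suc n) V E"
    and "independent_set V (complement_edges (Suc n) V E) K"
  shows "(\<Sum>x\<in>K. f x) \<le> real n"
  using assms
proof (induction n arbitrary: V E f K)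
  case 0
  have "f x = 0" if "x \<in> K" for x
  proof -
    have "{x} \<in> [K]\<^bsup>Suc 0\<^esup>" using that by (simp add: nsets_def)
    then have "{x} \<in> E"
      using 0(3) unfolding independent_set_complement_iff by blast
    then have "{indicator I | I. independent_set V E I} \<subseteq> {g :: 'a \<Rightarrow> real. g x = 0}"
      by (auto simp: independent_set_def indicator_def)
    moreover have "convex {g :: 'a \<Rightarrow> real. g x = 0}"
      by (auto simp: convex_def scaleR_fun_def)
    ultimately have "convex hull {indicator I | I. independent_set V E I}
        \<subseteq> {g :: 'a \<Rightarrow> real. g x = 0}"
      by (rule hull_minimal)
    then show ?thesis
      using 0(2) by (auto simp: independent_set_polytope_def)
  qed
  then show ?case by simp
next
  case (Suc n)
  let ?U = "link_vertices V E"
  let ?T = "\<lambda>x. theta_body (Suc n) (?U x) (link_edges (Suc (Suc n)) V E x)"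
  obtain F where f: "f = vec_restrict (\<lambda>x. F x x) V"
    and rows: "\<And>x. x \<in> V \<Longrightarrow> ?U x \<noteq> {} \<Longrightarrow>
      vec_restrict (F x) (?U x) \<in> (\<lambda>g. F x x *\<^sub>R g) ` ?T x"
    and psd: "psd_on (insert None (Some ` V)) (bordered F)"
    using Suc.prems(2) by auto
  have KV: "K \<subseteq> V" using Suc.prems(3) by (simp add: independent_set_def)
  then have "finite K" using Suc.prems(1) finite_subset by blast
  have diag: "0 \<le> F x x" "F x x \<le> 1" if "x \<in> K" for x
    using psd_bordered_diagonal_bounds[OF Suc.prems(1) psd] that KV by blast+
  define s where "s = (\<Sum>x\<in>K. F x x)"
  have f_sum: "(\<Sum>x\<in>K. f x) = s"
    unfolding f s_def vec_restrict_def using KV by (intro sum.cong) auto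
  show ?case
  proof (cases "Suc (Suc n) \<le> card K")
    case False
    have "s \<le> (\<Sum>x\<in>K. 1)" unfolding s_def by (intro sum_mono diag)
    also have "\<dots> \<le> real (Suc n)" using False by simp
    finally show ?thesis by (simp add: f_sum)
  next
    case True
    have row_sum: "(\<Sum>y\<in>K. F x y) \<le> real (Suc n) * F x x" if x: "x \<in> K" for x
    proof -
      have sub: "K - {x} \<subseteq> ?U x"
        by (rule clique_minus_vertex_subset_link[OF Suc.prems(1,3) True x])
      have "K - {x} \<noteq> {}"
      proof
        assume "K - {x} = {}"
        then have "card K \<le> card {x}" by (intro card_mono) auto
        with True show False by simp
      qed
      with sub rows[of x] x KV
      obtain g where g: "g \<in> ?T x" "vec_restrict (F x) (?U x) = F x x *\<^sub>R g" by blast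
      have "F x y = F x x * g y" if "y \<in> K - {x}" for y
        using fun_cong[OF g(2), of y] that sub
        by (auto simp: vec_restrict_def scaleR_fun_def)
      then have "(\<Sum>y\<in>K - {x}. F x y) = F x x * (\<Sum>y\<in>K - {x}. g y)"
        by (simp add: sum_distrib_left)
      also have "\<dots> \<le> F x x * real n"
        by (intro mult_left_mono diag x Suc.IH[OF _ g(1)]
            clique_minus_vertex_clique_in_link[OF Suc.prems(1,3) True x]
            finite_subset[OF link_vertices_subset Suc.prems(1)])
      finally show ?thesis
        using \<open>finite K\<close> x by (simp add: sum.remove[of K x] algebra_simps)
    qed
    have "s\<^sup>2 \<le> (\<Sum>x\<in>K. \<Sum>y\<in>K. F x y)"
      unfolding s_def by (rule psd_bordered_diagonal_sum_sq[OF Suc.prems(1) psd KV])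
    also have "\<dots> \<le> (\<Sum>x\<in>K. real (Suc n) * F x x)"
      by (intro sum_mono row_sum)
    also have "\<dots> = real (Suc n) * s"
      by (simp add: s_def sum_distrib_left)
    finally have "s * s \<le> real (Suc n) * s" by (simp add: power2_eq_square)
    moreover have "0 \<le> s" unfolding s_def by (intro sum_nonneg diag)
    ultimately have "s \<le> real (Suc n)"
      by (cases "s = 0") auto
    then show ?thesis by (simp add: f_sum)
  qed
qed

section \<open>The fractional chromatic number is attained\<close>

text \<open>
  Coefficients that belong to the same independent set can be added up, so lists of arbitrary
  length may be replaced by weights on the finite family of all independent sets.
\<close>

lemma decomposition_iff_weights:
  fixes w :: "'a \<Rightarrow> real"
  assumes "finite J"
  shows "(\<exists>(k::nat) l (I :: nat \<Rightarrow> 'a set). (\<forall>i\<in>{1..k}. 0 \<le> l i \<and> I i \<in> J) \<and>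
       (\<Sum>i=1..k. l i *\<^sub>R indicator (I i)) = w \<and> s = (\<Sum>i=1..k. l i)) \<longleftrightarrow>
    (\<exists>u. (\<forall>S\<in>J. 0 \<le> u S) \<and> (\<Sum>S\<in>J. u S *\<^sub>R indicator S) = w \<and> s = sum u J)"
    (is "?list \<longleftrightarrow> ?weights")
proof
  assume ?list
  then obtain k :: nat and l and I :: "nat \<Rightarrow> 'a set" where
    l: "\<And>i. i \<in> {1..k} \<Longrightarrow> 0 \<le> l i" and I: "I ` {1..k} \<subseteq> J"
    and w: "(\<Sum>i=1..k. l i *\<^sub>R indicator (I i)) = w" and s: "s = (\<Sum>i=1..k. l i)"
    by blast
  define u where "u S = sum l {i \<in> {1..k}. I i = S}" for S
  have "(\<Sum>S\<in>J. u S *\<^sub>R indicator S)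
      = (\<Sum>S\<in>J. \<Sum>i\<in>{i \<in> {1..k}. I i = S}. l i *\<^sub>R (indicator (I i) :: 'a \<Rightarrow> real))"
    unfolding u_def scaleR_sum_left by (intro sum.cong) auto
  also have "\<dots> = w"
    unfolding w[symmetric] by (rule sum.group) (use assms I in auto)
  finally have "(\<Sum>S\<in>J. u S *\<^sub>R indicator S) = w" .
  moreover have "sum u J = s"
    unfolding u_def s by (rule sum.group) (use assms I in auto)
  moreover have "0 \<le> u S" for S
    unfolding u_def by (intro sum_nonneg l) auto
  ultimately show ?weights by (intro exI[of _ u]) simp
next
  assume ?weights
  then obtain u where u: "\<And>S. S \<in> J \<Longrightarrow> 0 \<le> u S" "(\<Sum>S\<in>J. u S *\<^sub>R indicator S) = w" "s = sum u J"
    by blast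
  obtain h where h: "bij_betw h {1..card J} J"
    using ex_bij_betw_nat_finite_1[OF assms] by blast
  have "(\<Sum>i=1..card J. u (h i) *\<^sub>R (indicator (h i) :: 'a \<Rightarrow> real)) = w"
    unfolding u(2)[symmetric]
    by (rule sum.reindex_bij_betw[OF h, of "\<lambda>S. u S *\<^sub>R indicator S"])
  moreover have "s = (\<Sum>i=1..card J. u (h i))"
    unfolding u(3) by (rule sum.reindex_bij_betw[OF h, symmetric])
  moreover have "\<forall>i\<in>{1..card J}. 0 \<le> u (h i) \<and> h i \<in> J"
    using u(1) bij_betwE[OF h] by blast
  ultimately show ?list
    by (intro exI[of _ "card J"] exI[of _ "\<lambda>i. u (h i)"] exI[of _ h]) simp
qed

text \<open>
  Compactness gives a minimum only over the decompositions of total weight at most that of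
  \<open>u0\<close>; every other decomposition is worse than \<open>u0\<close> and therefore worse than the minimum.
\<close>

lemma min_weight_decomposition:
  fixes w :: "'a \<Rightarrow> real"
  assumes fin: "finite J" and u0: "\<And>S. S \<in> J \<Longrightarrow> 0 \<le> u0 S" "(\<Sum>S\<in>J. u0 S *\<^sub>R indicator S) = w"
  obtains u where "\<And>S. S \<in> J \<Longrightarrow> 0 \<le> u S" and "(\<Sum>S\<in>J. u S *\<^sub>R indicator S) = w"
    and "\<And>v. (\<And>S. S \<in> J \<Longrightarrow> 0 \<le> v S) \<Longrightarrow> (\<Sum>S\<in>J. v S *\<^sub>R indicator S) = w \<Longrightarrow>
      sum u J \<le> sum v J"
proof -
  define W where
    "W = {u. \<forall>S. u S \<in> (if S \<in> J then {0..sum u0 J} else {0})}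
       \<inter> {u. \<forall>x. (\<Sum>S\<in>J. u S * indicator S x) = w x}"
  have "compact W"
    unfolding W_def
    by (intro compact_Int_closed compact_function_box closed_Collect_all closed_Collect_eq
        continuous_intros continuous_on_coordinate) auto
  have decomp: "(\<Sum>S\<in>J. v S *\<^sub>R indicator S) = w \<longleftrightarrow> (\<forall>x. (\<Sum>S\<in>J. v S * indicator S x) = w x)" for v
    by (simp add: fun_eq_iff sum_fun_apply scaleR_fun_def)
  \<comment> \<open>A decomposition that is no worse than \<open>u0\<close> lies in \<open>W\<close> once it is set to \<open>0\<close> off \<open>J\<close>.\<close>
  have in_W: "(\<lambda>S. if S \<in> J then v S else 0) \<in> W"
    if "\<And>S. S \<in> J \<Longrightarrow> 0 \<le> v S" "(\<Sum>S\<in>J. v S *\<^sub>R indicator S) = w" "sum v J \<le> sum u0 J" for v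
  proof -
    have "v S \<le> sum u0 J" if "S \<in> J" for S
      using member_le_sum[of S J v] that \<open>\<And>S. S \<in> J \<Longrightarrow> 0 \<le> v S\<close> fin \<open>sum v J \<le> sum u0 J\<close>
      by auto
    then show ?thesis
      using that unfolding W_def decomp by (simp cong: sum.cong)
  qed
  then have "W \<noteq> {}" using u0 by blast
  moreover have "continuous_on W (\<lambda>u. sum u J)"
    by (intro continuous_intros continuous_on_coordinate)
  ultimately obtain u where u: "u \<in> W" and min: "\<And>v. v \<in> W \<Longrightarrow> sum u J \<le> sum v J"
    using continuous_attains_inf[OF \<open>compact W\<close>] by blast
  show thesis
  proof
    show "0 \<le> u S" if "S \<in> J" for S
      using u that unfolding W_def by (fastforce split: if_splits)
    show "(\<Sum>S\<in>J. u S *\<^sub>R indicator S) = w"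
      using u unfolding W_def decomp by auto
    have min': "sum u J \<le> sum v J" if "\<And>S. S \<in> J \<Longrightarrow> 0 \<le> v S"
      "(\<Sum>S\<in>J. v S *\<^sub>R indicator S) = w" "sum v J \<le> sum u0 J" for v
      using min[OF in_W[OF that]] by (simp cong: sum.cong)
    show "sum u J \<le> sum v J" if "\<And>S. S \<in> J \<Longrightarrow> 0 \<le> v S"
      "(\<Sum>S\<in>J. v S *\<^sub>R indicator S) = w" for v
      using min'[OF that] min'[OF u0] by fastforce
  qed
qed

text \<open>
  This makes the set of decompositions nonempty: in an \<open>r\<close>-uniform hypergraph with \<open>r \<ge> 2\<close>
  all singletons are independent, and \<open>w\<close> is the combination of their characteristic vectors
  with coefficients \<open>w(x)\<close>.
\<close>

lemma singleton_decomposition: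
  assumes "finite V" and "w \<in> nonneg_vectors V"
    and "\<And>x. x \<in> V \<Longrightarrow> {x} \<in> J" and "finite J"
  obtains u where "\<And>S. S \<in> J \<Longrightarrow> 0 \<le> u S" and "(\<Sum>S\<in>J. u S *\<^sub>R indicator S) = w"
proof
  define u where "u S = (\<Sum>x\<in>V. if S = {x} then w x else 0)" for S
  show "0 \<le> u S" if "S \<in> J" for S
    using assms(2) unfolding u_def nonneg_vectors_def by (intro sum_nonneg) auto
  show "(\<Sum>S\<in>J. u S *\<^sub>R indicator S) = w"
  proof
    fix y
    have "(\<Sum>S\<in>J. u S *\<^sub>R indicator S) y
        = (\<Sum>S\<in>J. \<Sum>x\<in>V. if S = {x} then w x * indicator {x} y else 0)"
      unfolding sum_fun_apply scaleR_fun_def u_def real_scaleR_def sum_distrib_right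
      by (intro sum.cong) auto
    also have "\<dots> = (\<Sum>x\<in>V. \<Sum>S\<in>J. if S = {x} then w x * indicator {x} y else 0)"
      by (rule sum.swap)
    also have "\<dots> = (\<Sum>x\<in>V. w x * indicator {x} y)"
      using assms(3,4) by (intro sum.cong) auto
    also have "\<dots> = (\<Sum>x\<in>V. if x = y then w x else 0)"
      by (intro sum.cong) (auto simp: indicator_def)
    also have "\<dots> = w y"
      using assms(1,2) by (auto simp: nonneg_vectors_def)
    finally show "(\<Sum>S\<in>J. u S *\<^sub>R indicator S) y = w y" .
  qed
qed

lemma fractional_chromatic_number_attained:
  assumes "finite V" and "w \<in> nonneg_vectors V" and "\<And>x. x \<in> V \<Longrightarrow> independent_set V E {x}"
  obtains u where "\<And>S. independent_set V E S \<Longrightarrow> 0 \<le> u S"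
    and "(\<Sum>S | independent_set V E S. u S *\<^sub>R indicator S) = w"
    and "fractional_chromatic_number V E w = (\<Sum>S | independent_set V E S. u S)"
proof -
  let ?J = "{S. independent_set V E S}"
  have fin: "finite ?J" using assms(1) by (rule finite_independent_sets)
  obtain u0 where u0: "\<And>S. S \<in> ?J \<Longrightarrow> 0 \<le> u0 S" "(\<Sum>S\<in>?J. u0 S *\<^sub>R indicator S) = w"
    using singleton_decomposition[OF assms(1,2) _ fin] assms(3) by blast
  obtain u where u: "\<And>S. S \<in> ?J \<Longrightarrow> 0 \<le> u S" "(\<Sum>S\<in>?J. u S *\<^sub>R indicator S) = w"
    and min: "\<And>v. (\<And>S. S \<in> ?J \<Longrightarrow> 0 \<le> v S) \<Longrightarrow> (\<Sum>S\<in>?J. v S *\<^sub>R indicator S) = w \<Longrightarrow>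
      sum u ?J \<le> sum v ?J"
    using min_weight_decomposition[OF fin u0] by blast
  have "fractional_chromatic_number V E w = sum u ?J"
    unfolding fractional_chromatic_number_def
      decomposition_iff_weights[OF fin, unfolded mem_Collect_eq[of _ "independent_set V E"]]
  proof (rule Least_equality)
    show "\<exists>v. (\<forall>S\<in>?J. 0 \<le> v S) \<and> (\<Sum>S\<in>?J. v S *\<^sub>R indicator S) = w \<and>
        sum u ?J = sum v ?J"
      using u by auto
  next
    fix s
    assume "\<exists>v. (\<forall>S\<in>?J. 0 \<le> v S) \<and> (\<Sum>S\<in>?J. v S *\<^sub>R indicator S) = w \<and>
        s = sum v ?J"
    then show "sum u ?J \<le> s" using min by auto
  qed
  with u show ?thesis by (intro that[of u]) auto
qed

section \<open>The sandwich inequality\<close>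

theorem corollary2p3:
  fixes r :: nat and V :: "'a set" and E :: "'a set set" and w :: "'a \<Rightarrow> real"
  assumes "r \<ge> 1"
    and "uniform_hypergraph r V E"
    and "w \<in> nonneg_vectors V"
  shows "independence_number V E w \<le> theta_number r V E w \<and>
    (r \<ge> 2 \<longrightarrow>
      theta_number r V E w
        \<le> (real r - 1) * fractional_chromatic_number V (complement_edges r V E) w)"
proof -
  obtain n where r: "r = Suc n" using assms(1) by (cases r) auto
  have fin: "finite V" and E: "E \<subseteq> [V]\<^bsup>Suc n\<^esup>"
    using assms(2) by (auto simp: uniform_hypergraph_def r)
  have empty: "independent_set V E {}"
    using E by (auto simp: independent_set_def nsets_def)
  then have "theta_body (Suc n) V E \<noteq> {}"
    using indicator_in_theta_body[OF fin] by blast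
  then obtain f where f: "f \<in> theta_body (Suc n) V E"
    and theta: "theta_number (Suc n) V E w = (\<Sum>x\<in>V. w x * f x)"
    and max: "\<And>g. g \<in> theta_body (Suc n) V E \<Longrightarrow> (\<Sum>x\<in>V. w x * g x) \<le> (\<Sum>x\<in>V. w x * f x)"
    using theta_number_attained[OF fin] by blast
  have lower: "independence_number V E w \<le> theta_number r V E w"
    unfolding independence_number_def
  proof (rule Max.boundedI)
    show "finite {\<Sum>x\<in>I. w x | I. independent_set V E I}"
      using finite_independent_sets[OF fin, of E] by simp
    show "{\<Sum>x\<in>I. w x | I. independent_set V E I} \<noteq> {}"
      using empty by blast
    fix a assume "a \<in> {\<Sum>x\<in>I. w x | I. independent_set V E I}"
    then obtain I where a: "a = (\<Sum>x\<in>I. w x)" and I: "independent_set V E I" by blast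
    have "a = (\<Sum>x\<in>V. w x * indicator I x)"
    proof -
      have "I \<subseteq> V" using I by (simp add: independent_set_def)
      then show ?thesis
        unfolding a using fin by (intro sum.mono_neutral_cong_left) auto
    qed
    also have "\<dots> \<le> theta_number r V E w"
      unfolding r theta by (intro max indicator_in_theta_body fin I)
    finally show "a \<le> theta_number r V E w" .
  qed
  have upper: "theta_number r V E w
      \<le> (real r - 1) * fractional_chromatic_number V (complement_edges r V E) w" if "r \<ge> 2"
  proof -
    let ?C = "complement_edges r V E"
    have "independent_set V ?C {x}" if "x \<in> V" for x
    proof -
      have "\<not> e \<subseteq> {x}" if "e \<in> ?C" for e
        using that \<open>r \<ge> 2\<close> card_mono[of "{x}" e]
        by (auto simp: complement_edges_def nsets_def)
      then show ?thesis using that unfolding independent_set_def by blast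
    qed
    then obtain u where u: "\<And>S. independent_set V ?C S \<Longrightarrow> 0 \<le> u S"
      and w: "(\<Sum>S | independent_set V ?C S. u S *\<^sub>R indicator S) = w"
      and chi: "fractional_chromatic_number V ?C w = (\<Sum>S | independent_set V ?C S. u S)"
      using fractional_chromatic_number_attained[OF fin assms(3)] by blast
    have "w x = (\<Sum>S | independent_set V ?C S. u S * indicator S x)" for x
      by (subst w[symmetric]) (simp add: sum_fun_apply scaleR_fun_def)
    then have "theta_number r V E w
        = (\<Sum>x\<in>V. \<Sum>S | independent_set V ?C S. u S * (indicator S x * f x))"
      unfolding r theta by (simp add: sum_distrib_right mult.assoc)
    also have "\<dots> = (\<Sum>S | independent_set V ?C S. u S * (\<Sum>x\<in>V. indicator S x * f x))"
      unfolding sum_distrib_left by (rule sum.swap)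
    also have "\<dots> \<le> (\<Sum>S | independent_set V ?C S. u S * real n)"
    proof (intro sum_mono mult_left_mono)
      fix S assume "S \<in> {S. independent_set V ?C S}"
      then have S: "independent_set V ?C S" by simp
      then show "0 \<le> u S" by (rule u)
      have "S \<subseteq> V" using S by (simp add: independent_set_def)
      then have "(\<Sum>x\<in>V. indicator S x * f x) = (\<Sum>x\<in>S. f x)"
        using fin by (intro sum.mono_neutral_cong_right) auto
      also have "\<dots> \<le> real n"
        using S by (intro theta_body_clique_bound[OF fin f]) (simp add: r)
      finally show "(\<Sum>x\<in>V. indicator S x * f x) \<le> real n" .
    qed
    also have "\<dots> = (real r - 1) * fractional_chromatic_number V ?C w"
      unfolding chi by (simp add: r sum_distrib_left mult.commute)
    finally show ?thesis .
  qed
  show ?thesis using lower upper by blast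
qed

end
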